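(* Let $X$ be a set. The structures of an algebraic convex-like structure on $X$ and of a convex space on $X$ mutually determine each other by the identity $cc_\lambda(x,y)=\gamma_{\lambda,1-\lambda}(x,y)$ for $x,y\in X$, $\lambda\in[0,1]$. That is: if $\{\gamma_\mu\}$ is a family satisfying the algebraic convex-like axioms (A1)--(A4), then the operations $cc_\lambda$ defined by this identity make $X$ into a convex space; and conversely, for every convex space structure $\{cc_\lambda\}_{\lambda\in[0,1]}$ on $X$ there exists a unique family $\{\gamma_\mu\}$ satisfying (A1)--(A4) such that this identity holds.
   Context: For $n\ge 1$, $\mathrm{Prob}_n$ denotes the set of probability measures on $\{1,\ldots,n\}$. For $\mu\in\mathrm{Prob}_2$ with $\mu(1)=\lambda$, $\mu(2)=1-\lambda$, write $\gamma_{\lambda,1-\lambda}$ for $\gamma_\mu$. An algebraic convex-like structure on a set $X$ is a family of maps $\gamma_\mu\colon X^n\to X$, one for each $n\ge 1$ and $\mu\in\mathrm{Prob}_n$ (no metric or continuity assumed), such that: (A1) for each permutation $\sigma\in S_n$ and $x_1,\ldots,x_n\in X$, $\gamma_\mu(x_1,\ldots,x_n)=\gamma_{\mu\circ\sigma}(x_{\sigma(1)},\ldots,x_{\sigma(n)})$; (A2) if $n\ge 2$ and $x_1=x_2$, then $\gamma_\mu(x_1,x_2,\ldots,x_n)=\gamma_{\tilde\mu}(x_1,x_3,\ldots,x_n)$, where $\tilde\mu\in\mathrm{Prob}_{n-1}$ is given by $\tilde\mu(1)=\mu(1)+\mu(2)$ and $\tilde\mu(j)=\mu(j+1)$ for $2\le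 j\le n-1$; (A3) if $\mu(i)=1$, then $\gamma_\mu(x_1,\ldots,x_n)=x_i$; (A4) for all $\nu\in\mathrm{Prob}_2$, $\mu\in\mathrm{Prob}_n$, $\tilde\mu\in\mathrm{Prob}_m$ and $x_1,\ldots,x_n,\tilde x_1,\ldots,\tilde x_m\in X$, $\gamma_\nu(\gamma_\mu(x_1,\ldots,x_n),\gamma_{\tilde\mu}(\tilde x_1,\ldots,\tilde x_m))=\gamma_\eta(x_1,\ldots,x_n,\tilde x_1,\ldots,\tilde x_m)$, where $\eta\in\mathrm{Prob}_{n+m}$ is given by $\eta(i)=\nu(1)\mu(i)$ for $1\le i\le n$ and $\eta(n+j)=\nu(2)\tilde\mu(j)$ for $1\le j\le m$. A convex space is a set $X$ with a family of binary operations $\{cc_\lambda\}_{\lambda\in[0,1]}$ on $X$ such that for all $x,y,z\in X$ and $\lambda,\mu\in[0,1]$: (i) $cc_0(x,y)=y$; (ii) $cc_\lambda(x,x)=x$; (iii) $cc_\lambda(x,y)=cc_{1-\lambda}(y,x)$; (iv) $cc_\lambda(cc_\mu(x,y),z)=cc_{\lambda\mu}(x,cc_\nu(y,z))$, where $\nu\in[0,1]$ is arbitrary if $\lambda=\mu=1$ and $\nu=\frac{\lambda(1-\mu)}{1-\lambda\mu}$ otherwise. (Intuitively, $cc_\lambda(x,y)$ stands for $\lambda x+(1-\lambda)y$.) *)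

theory Defs
  imports "HOL-Probability.Probability_Mass_Function" "HOL-Combinatorics.Permutations"
begin

text \<open>
  Points and weights are indexed from \<open>0\<close>, so that list positions can be used directly:
  the tuple \<open>(x\<^sub>1, \<dots>, x\<^sub>n)\<close> is a list of length \<open>n\<close> and \<open>Prob n\<close> consists of the probability
  measures on \<open>{0, \<dots>, n - 1}\<close>.  As \<open>Prob 0\<close> is empty, \<open>\<mu> \<in> Prob n\<close> entails \<open>n \<ge> 1\<close>.
\<close>

definition Prob :: "nat \<Rightarrow> nat pmf set" where
  "Prob n = {\<mu>. set_pmf \<mu> \<subseteq> {..<n}}"

definition tuples :: "'a set \<Rightarrow> nat \<Rightarrow> 'a list set" where
  "tuples X n = {xs. length xs = n \<and> set xs \<subseteq> X}"

lemma Prob_0: "Prob 0 = {}"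
  by (auto simp: Prob_def set_pmf_not_empty)

definition two_point :: "real \<Rightarrow> nat pmf" where
  "two_point l = map_pmf (\<lambda>b. if b then 0 else 1) (bernoulli_pmf l)"

text \<open>The density of \<open>permute_pmf \<sigma> \<mu>\<close> is that of \<open>\<mu>\<close> composed with \<open>\<sigma>\<close>.\<close>

definition permute_pmf :: "(nat \<Rightarrow> nat) \<Rightarrow> nat pmf \<Rightarrow> nat pmf" where
  "permute_pmf \<sigma> \<mu> = map_pmf (inv \<sigma>) \<mu>"

text \<open>Truncated subtraction sends both \<open>0\<close> and \<open>1\<close> to \<open>0\<close>, and \<open>j + 1\<close> to \<open>j\<close>.\<close>

definition merge_pmf :: "nat pmf \<Rightarrow> nat pmf" where
  "merge_pmf \<mu> = map_pmf (\<lambda>i. i - 1) \<mu>"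

definition join_pmf :: "nat \<Rightarrow> nat pmf \<Rightarrow> nat pmf \<Rightarrow> nat pmf \<Rightarrow> nat pmf" where
  "join_pmf n \<nu> \<mu> \<mu>' = bind_pmf \<nu> (\<lambda>k. if k = 0 then \<mu> else map_pmf (\<lambda>j. n + j) \<mu>')"

lemma two_point_in_Prob: "two_point l \<in> Prob 2"
  by (auto simp: two_point_def Prob_def)

lemma pmf_two_point:
  assumes "l \<in> {0..1}"
  shows "pmf (two_point l) 0 = l" "pmf (two_point l) 1 = 1 - l"
proof -
  have inj: "inj (\<lambda>b. if b then 0 else (1::nat))"
    by (auto simp: inj_on_def split: if_splits)
  show "pmf (two_point l) 0 = l"
    using pmf_map_inj'[OF inj, of "bernoulli_pmf l" True] assms by (simp add: two_point_def)
  show "pmf (two_point l) 1 = 1 - l"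
    using pmf_map_inj'[OF inj, of "bernoulli_pmf l" False] assms by (simp add: two_point_def)
qed

lemma permute_pmf_in_Prob:
  assumes "\<mu> \<in> Prob n" "\<sigma> permutes {..<n}"
  shows "permute_pmf \<sigma> \<mu> \<in> Prob n"
  using assms permutes_in_image[OF permutes_inv[OF assms(2)]]
  by (auto simp: Prob_def permute_pmf_def)

lemma pmf_permute_pmf:
  assumes "\<sigma> permutes {..<n}"
  shows "pmf (permute_pmf \<sigma> \<mu>) i = pmf \<mu> (\<sigma> i)"
proof -
  have "inj (inv \<sigma>)"
    using permutes_inv[OF assms] by (rule permutes_inj)
  from pmf_map_inj'[OF this, of \<mu> "\<sigma> i"] show ?thesis
    by (simp add: permute_pmf_def permutes_inverses(2)[OF assms])
qed

lemma merge_pmf_in_Prob: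
  assumes "\<mu> \<in> Prob n" "n \<ge> 2"
  shows "merge_pmf \<mu> \<in> Prob (n - 1)"
  using assms by (fastforce simp: Prob_def merge_pmf_def)

lemma pmf_merge_pmf:
  shows "pmf (merge_pmf \<mu>) 0 = pmf \<mu> 0 + pmf \<mu> 1"
    and "j \<ge> 1 \<Longrightarrow> pmf (merge_pmf \<mu>) j = pmf \<mu> (j + 1)"
proof -
  have "(\<lambda>i. i - 1) -` {0} = {0, 1::nat}" by auto
  then show "pmf (merge_pmf \<mu>) 0 = pmf \<mu> 0 + pmf \<mu> 1"
    by (simp add: merge_pmf_def pmf_map measure_measure_pmf_finite)
  assume "j \<ge> 1"
  then have "(\<lambda>i. i - 1) -` {j} = {j + 1}" by auto
  then show "pmf (merge_pmf \<mu>) j = pmf \<mu> (j + 1)"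
    by (simp add: merge_pmf_def pmf_map measure_measure_pmf_finite)
qed

lemma join_pmf_in_Prob:
  assumes "\<mu> \<in> Prob n" "\<mu>' \<in> Prob m"
  shows "join_pmf n \<nu> \<mu> \<mu>' \<in> Prob (n + m)"
  using assms by (fastforce simp: Prob_def join_pmf_def split: if_splits)

lemma pmf_join_pmf:
  assumes "\<nu> \<in> Prob 2" "\<mu> \<in> Prob n"
  shows "i < n \<Longrightarrow> pmf (join_pmf n \<nu> \<mu> \<mu>') i = pmf \<nu> 0 * pmf \<mu> i"
    and "pmf (join_pmf n \<nu> \<mu> \<mu>') (n + j) = pmf \<nu> 1 * pmf \<mu>' j"
proof -
  let ?K = "\<lambda>k. if k = 0 then \<mu> else map_pmf (\<lambda>j. n + j) \<mu>'"
  have sub: "set_pmf \<nu> \<subseteq> {0, 1}"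
    using assms(1) by (auto simp: Prob_def)
  have eq: "pmf (join_pmf n \<nu> \<mu> \<mu>') a = pmf \<nu> 0 * pmf \<mu> a + pmf \<nu> 1 * pmf (map_pmf (\<lambda>j. n + j) \<mu>') a" for a
    unfolding join_pmf_def pmf_bind
    by (subst integral_measure_pmf_real[of "{0, 1}"]) (use sub in \<open>auto simp: mult.commute\<close>)
  show "pmf (join_pmf n \<nu> \<mu> \<mu>') i = pmf \<nu> 0 * pmf \<mu> i" if "i < n"
  proof -
    have "pmf (map_pmf (\<lambda>j. n + j) \<mu>') i = 0"
      by (rule pmf_map_outside) (use that in auto)
    then show ?thesis by (simp add: eq)
  qed
  have "pmf \<mu> (n + j) = 0"
    using assms(2) by (auto simp: Prob_def pmf_eq_0_set_pmf)
  moreover have "pmf (map_pmf (\<lambda>j. n + j) \<mu>') (n + j) = pmf \<mu>' j"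
    by (rule pmf_map_inj') auto
  ultimately show "pmf (join_pmf n \<nu> \<mu> \<mu>') (n + j) = pmf \<nu> 1 * pmf \<mu>' j"
    by (simp add: eq)
qed

text \<open>
  The map attached to \<open>\<mu> \<in> Prob n\<close> is \<open>\<gamma> \<mu>\<close> on lists of length \<open>n\<close>.  A measure on
  \<open>{0, \<dots>, n - 1}\<close> also lies in \<open>Prob m\<close> for every \<open>m \<ge> n\<close>; the length of the list selects
  which of these maps is meant.  Values of \<open>\<gamma> \<mu> xs\<close> with \<open>xs\<close> outside \<open>tuples X n\<close> for all
  \<open>n\<close> with \<open>\<mu> \<in> Prob n\<close> carry no meaning.
\<close>

locale convex_like =
  fixes X :: "'a set" and \<gamma> :: "nat pmf \<Rightarrow> 'a list \<Rightarrow> 'a"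
  assumes closed: "\<mu> \<in> Prob n \<Longrightarrow> xs \<in> tuples X n \<Longrightarrow> \<gamma> \<mu> xs \<in> X"
    and permute: "\<mu> \<in> Prob n \<Longrightarrow> xs \<in> tuples X n \<Longrightarrow> \<sigma> permutes {..<n} \<Longrightarrow>
      \<gamma> \<mu> xs = \<gamma> (permute_pmf \<sigma> \<mu>) (permute_list \<sigma> xs)"
    and merge: "n \<ge> 2 \<Longrightarrow> \<mu> \<in> Prob n \<Longrightarrow> x # y # xs \<in> tuples X n \<Longrightarrow> x = y \<Longrightarrow>
      \<gamma> \<mu> (x # y # xs) = \<gamma> (merge_pmf \<mu>) (x # xs)"
    and unit: "\<mu> \<in> Prob n \<Longrightarrow> xs \<in> tuples X n \<Longrightarrow> i < n \<Longrightarrow> pmf \<mu> i = 1 \<Longrightarrow>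
      \<gamma> \<mu> xs = xs ! i"
    and join: "\<nu> \<in> Prob 2 \<Longrightarrow> \<mu> \<in> Prob n \<Longrightarrow> \<mu>' \<in> Prob m \<Longrightarrow>
      xs \<in> tuples X n \<Longrightarrow> ys \<in> tuples X m \<Longrightarrow>
      \<gamma> \<nu> [\<gamma> \<mu> xs, \<gamma> \<mu>' ys] = \<gamma> (join_pmf n \<nu> \<mu> \<mu>') (xs @ ys)"

text \<open>
  In the associativity law below, \<open>\<kappa>\<close> is unconstrained within the unit interval when
  \<open>l = m = 1\<close>.
\<close>

locale convex_space =
  fixes X :: "'a set" and cc :: "real \<Rightarrow> 'a \<Rightarrow> 'a \<Rightarrow> 'a"
  assumes closed: "l \<in> {0..1} \<Longrightarrow> x \<in> X \<Longrightarrow> y \<in> X \<Longrightarrow> cc l x y \<in> X"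
    and zero: "x \<in> X \<Longrightarrow> y \<in> X \<Longrightarrow> cc 0 x y = y"
    and idem: "l \<in> {0..1} \<Longrightarrow> x \<in> X \<Longrightarrow> cc l x x = x"
    and commute: "l \<in> {0..1} \<Longrightarrow> x \<in> X \<Longrightarrow> y \<in> X \<Longrightarrow> cc l x y = cc (1 - l) y x"
    and assoc: "l \<in> {0..1} \<Longrightarrow> m \<in> {0..1} \<Longrightarrow> \<kappa> \<in> {0..1} \<Longrightarrow>
      (\<not> (l = 1 \<and> m = 1) \<Longrightarrow> \<kappa> = l * (1 - m) / (1 - l * m)) \<Longrightarrow>
      x \<in> X \<Longrightarrow> y \<in> X \<Longrightarrow> z \<in> X \<Longrightarrow>
      cc l (cc m x y) z = cc (l * m) x (cc \<kappa> y z)"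

definition corresponds ::
    "'a set \<Rightarrow> (nat pmf \<Rightarrow> 'a list \<Rightarrow> 'a) \<Rightarrow> (real \<Rightarrow> 'a \<Rightarrow> 'a \<Rightarrow> 'a) \<Rightarrow> bool" where
  "corresponds X \<gamma> cc \<longleftrightarrow>
    (\<forall>l\<in>{0..1}. \<forall>x\<in>X. \<forall>y\<in>X. cc l x y = \<gamma> (two_point l) [x, y])"

end

theory Submission
  imports Defs
begin

text \<open>
  Every \<open>\<gamma> \<mu> xs\<close> is determined by the binary operations: split off the first point, so that
  \<open>\<mu>\<close> becomes a mixture of a point mass and a measure on fewer points, and use the join axiom.
  For existence, evaluate a list of positively weighted points by iterating the operations from
  the right.  Associativity gives a formula for the value of a concatenation; with commutativity
  and idempotence, the value depends only on the total weight that each point of \<open>X\<close> carries.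
  Hence each finitely supported measure on \<open>X\<close> has a barycenter, which turns mixtures into
  binary operations, and \<open>\<gamma> \<mu> xs\<close> is taken to be the barycenter of the image of \<open>\<mu>\<close>
  under \<open>i \<mapsto> xs ! i\<close>.
\<close>

section \<open>Measures on initial segments of the natural numbers\<close>

lemma bind_two_point:
  "bind_pmf (two_point l) (\<lambda>k. if k = 0 then p else q) =
    bind_pmf (bernoulli_pmf l) (\<lambda>b. if b then p else q)"
  by (auto simp: two_point_def bind_map_pmf intro!: bind_pmf_cong)

text \<open>The join axiom ranges over all of \<open>Prob 2\<close>, while the binary operations
  only see \<open>two_point\<close>; this bridges the two.\<close>

lemma Prob_2_eq_two_point:
  assumes "\<nu> \<in> Prob 2"
  shows "\<nu> = two_point (pmf \<nu> 0)"
proof (rule pmf_eqI)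
  fix i :: nat
  have sub: "set_pmf \<nu> \<subseteq> {0, 1}"
    using assms by (auto simp: Prob_def)
  have "(\<Sum>i\<in>{0, 1}. pmf \<nu> i) = 1"
    by (rule sum_pmf_eq_1) (use sub in auto)
  then have one: "pmf \<nu> 1 = 1 - pmf \<nu> 0"
    by simp
  have l: "pmf \<nu> 0 \<in> {0..1}"
    by (simp add: pmf_le_1)
  consider "i = 0" | "i = 1" | "i \<ge> 2" by linarith
  then show "pmf \<nu> i = pmf (two_point (pmf \<nu> 0)) i"
  proof cases
    case 3
    then have "i \<notin> set_pmf \<nu>" "i \<notin> set_pmf (two_point (pmf \<nu> 0))"
      using sub two_point_in_Prob[of "pmf \<nu> 0"] by (auto simp: Prob_def)
    then show ?thesis by (simp add: set_pmf_iff)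
  qed (use one pmf_two_point[OF l] in auto)
qed

lemma pmf_Prob_outside: "\<mu> \<in> Prob n \<Longrightarrow> n \<le> i \<Longrightarrow> pmf \<mu> i = 0"
  by (force simp: Prob_def set_pmf_iff)

lemma pmf_eq_1:
  assumes "pmf \<mu> i = 1"
  shows "\<mu> = return_pmf i"
proof -
  have "measure_pmf.prob \<mu> {i} = 1"
    using assms by (simp add: measure_pmf_single)
  then have "set_pmf \<mu> \<subseteq> {i}"
    by (simp add: measure_pmf.prob_eq_1 AE_measure_pmf_iff subset_iff)
  then show ?thesis
    by (simp add: set_pmf_subset_singleton)
qed

lemma Prob_eqI:
  assumes "\<mu> \<in> Prob n" "\<mu>' \<in> Prob n" "\<And>i. i < n \<Longrightarrow> pmf \<mu> i = pmf \<mu>' i"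
  shows "\<mu> = \<mu>'"
  using assms by (intro pmf_eqI) (metis not_le pmf_Prob_outside)

lemma return_pmf_0_in_Prob: "return_pmf 0 \<in> Prob (Suc 0)"
  by (simp add: Prob_def)

section \<open>From convex-like structures to convex spaces\<close>

lemma permute_pmf_two_point:
  assumes "l \<in> {0..1}"
  shows "permute_pmf (Transposition.transpose 0 1) (two_point l) = two_point (1 - l)"
proof (rule Prob_eqI)
  have p: "Transposition.transpose 0 1 permutes {..<2::nat}"
    by (rule permutes_swap_id) auto
  show "permute_pmf (Transposition.transpose 0 1) (two_point l) \<in> Prob 2"
    by (rule permute_pmf_in_Prob[OF two_point_in_Prob p])
  show "two_point (1 - l) \<in> Prob 2"
    by (rule two_point_in_Prob)
  fix i :: nat
  assume "i < 2"
  then consider "i = 0" | "i = 1" by linarith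
  then show "pmf (permute_pmf (Transposition.transpose 0 1) (two_point l)) i = pmf (two_point (1 - l)) i"
    using assms pmf_two_point[of l] pmf_two_point[of "1 - l"]
    by cases (auto simp: pmf_permute_pmf[OF p] simp del: One_nat_def)
qed

text \<open>This is associativity at the level of measures: both nestings give the three points the
  weights \<open>l * m\<close>, \<open>l * (1 - m)\<close> and \<open>1 - l\<close>.\<close>

lemma join_pmf_two_point_assoc:
  assumes "l \<in> {0..1}" "m \<in> {0..1}" "\<kappa> \<in> {0..1}"
    and \<kappa>: "\<not> (l = 1 \<and> m = 1) \<Longrightarrow> \<kappa> = l * (1 - m) / (1 - l * m)"
  shows "join_pmf 2 (two_point l) (two_point m) (return_pmf 0) =
    join_pmf 1 (two_point (l * m)) (return_pmf 0) (two_point \<kappa>)"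
    (is "?L = ?R")
proof (rule Prob_eqI)
  have lm: "l * m \<in> {0..1}"
    using assms by (auto intro: mult_le_one)
  show "?L \<in> Prob 3"
    using join_pmf_in_Prob[OF two_point_in_Prob return_pmf_0_in_Prob] by simp
  show "?R \<in> Prob 3"
    using join_pmf_in_Prob[where \<nu> = "two_point (l * m)" and \<mu>' = "two_point \<kappa>",
        OF return_pmf_0_in_Prob two_point_in_Prob]
    by (simp add: numeral_3_eq_3)
  \<comment> \<open>Cleared of the denominator, the condition on \<open>\<kappa>\<close> also covers
    \<open>l = m = 1\<close>, where both sides vanish whatever \<open>\<kappa>\<close> is.\<close>
  have eq: "(1 - l * m) * \<kappa> = l * (1 - m)"
  proof (cases "l * m = 1")
    case True
    with assms have "l = 1 \<and> m = 1"
      by (smt (verit) atLeastAtMost_iff mult_left_le mult_left_le_one_le)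
    then show ?thesis by simp
  next
    case False
    then have "\<kappa> = l * (1 - m) / (1 - l * m)" by (intro \<kappa>) auto
    then show ?thesis using False by simp
  qed
  note L = pmf_join_pmf[where \<nu> = "two_point l" and \<mu> = "two_point m" and \<mu>' = "return_pmf 0",
      OF two_point_in_Prob two_point_in_Prob]
  note R = pmf_join_pmf[where \<nu> = "two_point (l * m)" and \<mu>' = "two_point \<kappa>",
      OF two_point_in_Prob return_pmf_0_in_Prob]
  note tp = pmf_two_point[OF assms(1)] pmf_two_point[OF assms(2)] pmf_two_point[OF assms(3)]
    pmf_two_point[OF lm]
  fix i :: nat
  assume "i < 3"
  then consider "i = 0" | "i = 1" | "i = 2" by linarith
  then show "pmf ?L i = pmf ?R i"
  proof cases
    case 1
    then show ?thesis using L(1)[of 0] R(1)[of 0] tp by simp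
  next
    case 2
    then show ?thesis using L(1)[of 1] R(2)[of 0] tp eq by simp
  next
    case 3
    have "pmf ?L 2 = 1 - l"
      using L(2)[of 0] tp by simp
    moreover have "pmf ?R 2 = (1 - l * m) * (1 - \<kappa>)"
      using R(2)[of 1] tp by (simp add: numeral_2_eq_2)
    ultimately show ?thesis using 3 eq by (simp add: algebra_simps)
  qed
qed

context convex_like
begin

text \<open>The join axiom expects a value of \<open>\<gamma>\<close> in both arguments; this puts a
  bare point into that form.\<close>

lemma singleton: "x \<in> X \<Longrightarrow> \<gamma> (return_pmf 0) [x] = x"
  using unit[OF return_pmf_0_in_Prob, of "[x]" 0] by (simp add: tuples_def)

lemma convex_space: "convex_space X (\<lambda>l x y. \<gamma> (two_point l) [x, y])"
proof
  fix l x y assume "l \<in> {0..1::real}" and xy: "x \<in> X" "y \<in> X"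
  then show "\<gamma> (two_point l) [x, y] \<in> X"
    by (intro closed[OF two_point_in_Prob]) (simp add: tuples_def)
next
  fix x y assume "x \<in> X" "y \<in> X"
  then show "\<gamma> (two_point 0) [x, y] = y"
    using unit[OF two_point_in_Prob[of 0], of "[x, y]" 1] pmf_two_point[of 0]
    by (simp add: tuples_def)
next
  fix l x assume l: "l \<in> {0..1::real}" and x: "x \<in> X"
  have m: "merge_pmf (two_point l) \<in> Prob 1"
    using merge_pmf_in_Prob[OF two_point_in_Prob[of l]] by simp
  have "\<gamma> (two_point l) [x, x] = \<gamma> (merge_pmf (two_point l)) [x]"
    using merge[OF _ two_point_in_Prob[of l], of x x "[]"] x by (simp add: tuples_def)
  also have "\<dots> = [x] ! 0"
    by (rule unit[OF m]) (use x pmf_merge_pmf(1)[of "two_point l"] pmf_two_point[OF l] in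
        \<open>auto simp: tuples_def\<close>)
  finally show "\<gamma> (two_point l) [x, x] = x" by simp
next
  fix l x y assume l: "l \<in> {0..1::real}" and xy: "x \<in> X" "y \<in> X"
  have p: "Transposition.transpose 0 1 permutes {..<2::nat}"
    by (rule permutes_swap_id) auto
  have "permute_list (Transposition.transpose 0 1) [x, y] = [y, x]"
    by (simp add: permute_list_def upt_rec)
  then show "\<gamma> (two_point l) [x, y] = \<gamma> (two_point (1 - l)) [y, x]"
    using permute[OF two_point_in_Prob[of l] _ p, of "[x, y]"] xy permute_pmf_two_point[OF l]
    by (simp add: tuples_def)
next
  fix l m \<kappa> x y z
  assume lm: "l \<in> {0..1::real}" "m \<in> {0..1::real}" "\<kappa> \<in> {0..1::real}"
    "\<not> (l = 1 \<and> m = 1) \<Longrightarrow> \<kappa> = l * (1 - m) / (1 - l * m)"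
    and xyz: "x \<in> X" "y \<in> X" "z \<in> X"
  have "\<gamma> (two_point l) [\<gamma> (two_point m) [x, y], z] =
      \<gamma> (two_point l) [\<gamma> (two_point m) [x, y], \<gamma> (return_pmf 0) [z]]"
    using xyz by (simp add: singleton)
  also have "\<dots> = \<gamma> (join_pmf 2 (two_point l) (two_point m) (return_pmf 0)) [x, y, z]"
    using join[OF two_point_in_Prob two_point_in_Prob return_pmf_0_in_Prob,
        of "[x, y]" "[z]" l m] xyz by (simp add: tuples_def)
  also have "\<dots> = \<gamma> (join_pmf 1 (two_point (l * m)) (return_pmf 0) (two_point \<kappa>)) [x, y, z]"
    using join_pmf_two_point_assoc[OF lm] by simp
  also have "\<dots> = \<gamma> (two_point (l * m)) [\<gamma> (return_pmf 0) [x], \<gamma> (two_point \<kappa>) [y, z]]"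
    using join[OF two_point_in_Prob return_pmf_0_in_Prob two_point_in_Prob,
        of "[x]" "[y, z]" "l * m" \<kappa>] xyz by (simp add: tuples_def)
  also have "\<dots> = \<gamma> (two_point (l * m)) [x, \<gamma> (two_point \<kappa>) [y, z]]"
    using xyz by (simp add: singleton)
  finally show "\<gamma> (two_point l) [\<gamma> (two_point m) [x, y], z] =
    \<gamma> (two_point (l * m)) [x, \<gamma> (two_point \<kappa>) [y, z]]" .
qed

end

section \<open>Uniqueness\<close>

text \<open>The second component is \<mu> conditioned on avoiding 0 and shifted down by one. The
  conditioning makes sense because 0 does not carry all the mass.\<close>

lemma Prob_Suc_split:
  assumes \<mu>: "\<mu> \<in> Prob (Suc n)" and "pmf \<mu> 0 \<noteq> 1"
  obtains \<mu>' where "\<mu>' \<in> Prob n" "\<mu> = join_pmf 1 (two_point (pmf \<mu> 0)) (return_pmf 0) \<mu>'"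
proof -
  have l: "pmf \<mu> 0 \<in> {0..1}"
    by (simp add: pmf_le_1)
  have "\<not> set_pmf \<mu> \<subseteq> {0}"
  proof
    assume "set_pmf \<mu> \<subseteq> {0}"
    then have "\<mu> = return_pmf 0" by (simp add: set_pmf_subset_singleton)
    then show False using assms(2) by simp
  qed
  then have ne: "set_pmf \<mu> \<inter> - {0} \<noteq> {}" by blast
  define \<mu>' where "\<mu>' = map_pmf (\<lambda>i. i - 1) (cond_pmf \<mu> (- {0}))"
  have mem: "\<mu>' \<in> Prob n"
    using \<mu> by (force simp: \<mu>'_def Prob_def set_cond_pmf[OF ne])
  have meas: "measure_pmf.prob \<mu> (- {0}) = 1 - pmf \<mu> 0"
    using measure_pmf.prob_compl[of "{0}" \<mu>] by (simp add: Compl_eq_Diff_UNIV measure_pmf_single)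
  have pmf': "pmf \<mu>' i = pmf \<mu> (Suc i) / (1 - pmf \<mu> 0)" for i
  proof -
    have "pmf \<mu>' i = pmf (map_pmf Suc \<mu>') (Suc i)"
      by (rule pmf_map_inj'[symmetric]) simp
    \<comment> \<open>The conditioned measure avoids 0, so on its support \<open>Suc\<close> undoes
      truncated subtraction of 1.\<close>
    also have "map_pmf Suc \<mu>' = cond_pmf \<mu> (- {0})"
      unfolding \<mu>'_def pmf.map_comp
      by (rule trans[OF map_pmf_cong map_pmf_id[unfolded id_def, THEN fun_cong]])
        (auto simp: set_cond_pmf[OF ne])
    finally show ?thesis
      by (simp add: pmf_cond[OF ne] meas)
  qed
  have "\<mu> = join_pmf 1 (two_point (pmf \<mu> 0)) (return_pmf 0) \<mu>'" (is "_ = ?J")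
  proof (rule Prob_eqI[OF \<mu>])
    show "?J \<in> Prob (Suc n)"
      using join_pmf_in_Prob[OF return_pmf_0_in_Prob mem] by simp
    note J = pmf_join_pmf[where \<nu> = "two_point (pmf \<mu> 0)" and \<mu>' = \<mu>',
        OF two_point_in_Prob return_pmf_0_in_Prob]
    fix i
    show "pmf \<mu> i = pmf ?J i"
    proof (cases i)
      case 0
      then show ?thesis using J(1)[of 0] pmf_two_point[OF l] by simp
    next
      case (Suc j)
      then show ?thesis using J(2)[of j] pmf_two_point[OF l] assms(2) by (simp add: pmf')
    qed
  qed
  with mem show thesis by (rule that)
qed

text \<open>Induction on the number of points: if the first point has mass 1, the unit axiom gives
  both values; otherwise the join axiom reduces them to a binary operation applied to the first
  point and the value of a shorter tuple.\<close>

lemma convex_like_unique: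
  assumes "convex_like X \<gamma>" "convex_like X \<gamma>'"
    and eq: "\<And>l x y. l \<in> {0..1} \<Longrightarrow> x \<in> X \<Longrightarrow> y \<in> X \<Longrightarrow>
      \<gamma> (two_point l) [x, y] = \<gamma>' (two_point l) [x, y]"
  shows "\<mu> \<in> Prob n \<Longrightarrow> xs \<in> tuples X n \<Longrightarrow> \<gamma> \<mu> xs = \<gamma>' \<mu> xs"
proof (induction n arbitrary: \<mu> xs)
  case 0
  then show ?case by (simp add: Prob_0)
next
  case (Suc n)
  interpret G: convex_like X \<gamma> by fact
  interpret G': convex_like X \<gamma>' by fact
  show ?case
  proof (cases "pmf \<mu> 0 = 1")
    case True
    then show ?thesis
      using G.unit[OF Suc.prems, of 0] G'.unit[OF Suc.prems, of 0] by simp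
  next
    case False
    obtain \<mu>' where \<mu>': "\<mu>' \<in> Prob n"
      and split: "\<mu> = join_pmf 1 (two_point (pmf \<mu> 0)) (return_pmf 0) \<mu>'"
      using Prob_Suc_split[OF Suc.prems(1) False] .
    obtain x ys where xs: "xs = x # ys" and x: "x \<in> X" and ys: "ys \<in> tuples X n"
      using Suc.prems(2) by (cases xs) (auto simp: tuples_def)
    have x1: "[x] \<in> tuples X (Suc 0)"
      using x by (simp add: tuples_def)
    have l: "pmf \<mu> 0 \<in> {0..1}"
      by (simp add: pmf_le_1)
    have "\<gamma> \<mu> xs = \<gamma> (two_point (pmf \<mu> 0)) [x, \<gamma> \<mu>' ys]"
      using G.join[OF two_point_in_Prob return_pmf_0_in_Prob \<mu>' x1 ys, of "pmf \<mu> 0"] split x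
      by (simp add: xs G.singleton)
    \<comment> \<open>Closedness puts the value on the tail in X, so the agreement on pairs applies
      to it.\<close>
    also have "\<dots> = \<gamma>' (two_point (pmf \<mu> 0)) [x, \<gamma>' \<mu>' ys]"
      using eq[OF l x G.closed[OF \<mu>' ys]] Suc.IH[OF \<mu>' ys] by simp
    also have "\<dots> = \<gamma>' \<mu> xs"
      using G'.join[OF two_point_in_Prob return_pmf_0_in_Prob \<mu>' x1 ys, of "pmf \<mu> 0"] split x
      by (simp add: xs G'.singleton)
    finally show ?thesis .
  qed
qed

section \<open>Barycenters in a convex space\<close>

text \<open>A list of pairs (w, x) with positive weights stands for the sum of the point masses w at
  x. Total mass 1 is not demanded, so that tails and sublists are objects of the same kind.\<close>

definition mass :: "(real \<times> 'a) list \<Rightarrow> real" where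
  "mass L = sum_list (map fst L)"

definition weight :: "(real \<times> 'a) list \<Rightarrow> 'a \<Rightarrow> real" where
  "weight L x = mass (filter (\<lambda>p. snd p = x) L)"

definition rescale :: "real \<Rightarrow> (real \<times> 'a) list \<Rightarrow> (real \<times> 'a) list" where
  "rescale c L = map (map_prod ((*) c) id) L"

lemma mass_simps [simp]:
  "mass [] = 0" "mass (p # L) = fst p + mass L" "mass (L @ M) = mass L + mass M"
  by (simp_all add: mass_def)

lemma mass_rescale [simp]: "mass (rescale c L) = c * mass L"
  by (induction L) (simp_all add: rescale_def algebra_simps)

lemma weight_append [simp]: "weight (L @ M) x = weight L x + weight M x"
  by (simp add: weight_def)

lemma weight_rescale [simp]: "weight (rescale c L) x = c * weight L x"
  by (induction L) (auto simp: rescale_def weight_def algebra_simps)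

lemma weight_filter: "weight (filter (\<lambda>p. snd p \<noteq> y) L) x = (if x = y then 0 else weight L x)"
  by (induction L) (auto simp: weight_def)

lemma mass_split: "mass L = weight L x + mass (filter (\<lambda>p. snd p \<noteq> x) L)"
  by (induction L) (auto simp: weight_def)

lemma mass_mset_cong: "mset L = mset M \<Longrightarrow> mass L = mass M"
  by (metis mset_map sum_mset_sum_list mass_def)

lemma weight_distinct:
  "distinct xs \<Longrightarrow> weight (map (\<lambda>x. (f x, x)) xs) x = (if x \<in> set xs then f x else 0)"
  by (induction xs) (auto simp: weight_def)

section \<open>Values of positively weighted lists\<close>

context convex_space
begin

text \<open>Strict positivity gives nonempty lists positive mass, so the quotients below are
  genuine, and makes the points occurring in a list recoverable from its weights.\<close>

abbreviation weighted :: "(real \<times> 'a) list set" where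
  "weighted \<equiv> {L. set L \<subseteq> {0<..} \<times> X}"

text \<open>The empty list has no meaningful value; the test \<open>L = []\<close> keeps
  \<open>undefined\<close> out of the value of a nonempty list.\<close>

primrec combine :: "(real \<times> 'a) list \<Rightarrow> 'a" where
  "combine [] = undefined"
| "combine (p # L) =
    (if L = [] then snd p else cc (fst p / mass (p # L)) (snd p) (combine L))"

lemma mass_nonneg: "L \<in> weighted \<Longrightarrow> 0 \<le> mass L"
  by (induction L) auto

lemma mass_pos: "L \<in> weighted \<Longrightarrow> L \<noteq> [] \<Longrightarrow> 0 < mass L"
  by (cases L) (auto simp: add_pos_nonneg mass_nonneg)

lemma rescale_weighted: "0 < c \<Longrightarrow> L \<in> weighted \<Longrightarrow> rescale c L \<in> weighted"
  by (auto simp: rescale_def)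

lemma weight_pos_iff:
  assumes "L \<in> weighted"
  shows "weight L x > 0 \<longleftrightarrow> x \<in> snd ` set L"
proof -
  have f: "filter (\<lambda>p. snd p = x) L \<in> weighted"
    using assms by auto
  show ?thesis
    using mass_pos[OF f] by (cases "filter (\<lambda>p. snd p = x) L = []")
      (auto simp: weight_def filter_empty_conv image_iff)
qed

lemma combine_closed: "L \<in> weighted \<Longrightarrow> L \<noteq> [] \<Longrightarrow> combine L \<in> X"
proof (induction L)
  case (Cons p L)
  then show ?case
    using mass_nonneg[of L] by (auto intro!: closed)
qed simp

text \<open>Induction on L: the induction hypothesis evaluates the tail of L followed by M, and
  associativity then regroups the head with that tail.\<close>

lemma combine_append:
  assumes "L \<in> weighted" "M \<in> weighted" "L \<noteq> []" "M \<noteq> []"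
  shows "combine (L @ M) = cc (mass L / (mass L + mass M)) (combine L) (combine M)"
  using assms
proof (induction L)
  case (Cons p L)
  obtain w x where p: "p = (w, x)" by (cases p)
  with Cons.prems have w: "0 < w" and x: "x \<in> X" and L: "L \<in> weighted" by auto
  show ?case
  proof (cases "L = []")
    case True
    with p Cons.prems show ?thesis by simp
  next
    case False
    define s t where "s = mass L" and "t = mass M"
    have s: "0 < s" and t: "0 < t"
      using mass_pos L False Cons.prems by (auto simp: s_def t_def)
    have "cc ((w + s) / (w + s + t)) (cc (w / (w + s)) x (combine L)) (combine M) =
        cc ((w + s) / (w + s + t) * (w / (w + s))) x (cc (s / (s + t)) (combine L) (combine M))"
    \<comment> \<open>The inner parameter \<open>\<kappa>\<close> has to be the share of s in s + t;
      the product of the two outer parameters is the share of w in the total.\<close>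
    proof (rule assoc)
      show "s / (s + t) = (w + s) / (w + s + t) * (1 - w / (w + s)) /
          (1 - (w + s) / (w + s + t) * (w / (w + s)))"
      proof -
        have "1 - w / (w + s) = s / (w + s)" using w s by (simp add: field_simps)
        moreover have lm: "(w + s) / (w + s + t) * (w / (w + s)) = w / (w + s + t)"
          using w s by simp
        moreover have "1 - w / (w + s + t) = (s + t) / (w + s + t)"
          using w s t by (simp add: field_simps)
        ultimately show ?thesis using w s t by simp
      qed
    qed (use w s t x L False Cons.prems in \<open>auto intro!: combine_closed\<close>)
    moreover have "(w + s) / (w + s + t) * (w / (w + s)) = w / (w + (s + t))"
      using w s by (simp add: add.assoc)
    ultimately show ?thesis
      using Cons.IH[OF L Cons.prems(2) False Cons.prems(4)] False
      by (simp add: p s_def t_def add.assoc)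
  qed
qed simp

text \<open>Exchanging the two blocks replaces the share of the first by its complement, which is
  what the axiom \<open>commute\<close> does.\<close>

lemma combine_append_commute:
  assumes "L \<in> weighted" "M \<in> weighted"
  shows "combine (L @ M) = combine (M @ L)"
proof (cases "L = [] \<or> M = []")
  case False
  define s t where "s = mass L" and "t = mass M"
  have "0 < s" "0 < t"
    using mass_pos assms False by (auto simp: s_def t_def)
  then have "s / (s + t) \<in> {0..1}" "1 - s / (s + t) = t / (t + s)"
    by (auto simp: field_simps)
  then show ?thesis
    using False assms commute[of "s / (s + t)" "combine L" "combine M"]
    by (simp add: combine_append combine_closed s_def t_def)
qed auto

text \<open>Induction on L: the head p of L occurs somewhere in M, so it suffices to move it to the
  front of M.\<close>

lemma combine_mset_cong:
  "L \<in> weighted \<Longrightarrow> mset L = mset M \<Longrightarrow> combine L = combine M"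
proof (induction L arbitrary: M)
  case (Cons p L)
  then have "p \<in> set M" by (metis list.set_intros(1) mset_eq_setD)
  then obtain U V where M: "M = U @ p # V" by (meson split_list)
  have L: "mset L = mset (U @ V)"
    using Cons.prems(2) by (simp add: M)
  have "set M = set (p # L)"
    using Cons.prems(2) by (metis mset_eq_setD)
  then have "set U \<union> set V \<subseteq> set (p # L)"
    by (auto simp: M)
  then have w: "[p] \<in> weighted" "U \<in> weighted" "V \<in> weighted" "L \<in> weighted"
    using Cons.prems(1) by auto
  have front: "combine (U @ p # V) = combine (p # U @ V)"
  proof (cases "V = []")
    case True
    then show ?thesis using combine_append_commute[OF w(2) w(1)] by simp
  next
    case False
    \<comment> \<open>A block enters the value of a concatenation only through its mass and its own
      value, so p and U can be swapped in front of V.\<close>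
    have "combine ((U @ [p]) @ V) = combine (([p] @ U) @ V)"
      using w False combine_append_commute[OF w(2) w(1)]
        combine_append[of "U @ [p]" V] combine_append[of "[p] @ U" V]
      by (simp add: add.commute)
    then show ?thesis by simp
  qed
  have "combine (p # L) = combine (p # U @ V)"
    \<comment> \<open>Equal sizes ensure that the two tails pass or fail the emptiness test in
      \<open>combine\<close> together.\<close>
    using Cons.IH[OF w(4) L] mass_mset_cong[OF L] arg_cong[OF L, of size] by auto
  with front show ?case by (simp add: M)
qed simp

lemma combine_const:
  "L \<in> weighted \<Longrightarrow> L \<noteq> [] \<Longrightarrow> snd ` set L \<subseteq> {x} \<Longrightarrow> combine L = x"
proof (induction L)
  case (Cons p L)
  then show ?case
    using mass_nonneg[of L] by (cases "L = []") (auto intro!: idem)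
qed simp

text \<open>Reordering brings all entries at x to the front, where idempotence collapses them to
  x.\<close>

lemma combine_collect:
  assumes L: "L \<in> weighted" and x: "x \<in> snd ` set L"
    and rest: "filter (\<lambda>p. snd p \<noteq> x) L \<noteq> []"
  shows "combine L = cc (weight L x / mass L) x (combine (filter (\<lambda>p. snd p \<noteq> x) L))"
proof -
  let ?A = "filter (\<lambda>p. snd p = x) L" and ?B = "filter (\<lambda>p. snd p \<noteq> x) L"
  have w: "?A \<in> weighted" "?B \<in> weighted"
    using L by auto
  have A: "?A \<noteq> []"
    using x by (auto simp: filter_empty_conv)
  have "combine L = combine (?A @ ?B)"
    by (rule combine_mset_cong[OF L]) simp
  also have "\<dots> = cc (mass ?A / (mass ?A + mass ?B)) (combine ?A) (combine ?B)"
    by (rule combine_append[OF w A rest])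
  also have "combine ?A = x"
    by (rule combine_const[OF w(1) A]) auto
  also have "mass ?A + mass ?B = mass L"
    using mass_split[of L x] by (simp add: weight_def)
  finally show ?thesis by (simp add: weight_def)
qed

text \<open>Induction on the length of L: a point x of L also occurs in M, since it has positive
  weight there. Deleting x from both lists preserves equality of weights, and
  \<open>combine_collect\<close> restores x. Equal masses are proved alongside because the parameter
  in \<open>combine_collect\<close> is a quotient by the mass.\<close>

lemma combine_weight_cong:
  assumes "L \<in> weighted" "M \<in> weighted" "weight L = weight M"
  shows "mass L = mass M \<and> combine L = combine M"
  using assms
proof (induction "length L" arbitrary: L M rule: less_induct)
  case less
  have sets: "snd ` set L = snd ` set M"
    using less.prems weight_pos_iff by (metis subsetI subset_antisym)
  show ?case
  proof (cases L)
    case Nil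
    then show ?thesis using sets by simp
  next
    case (Cons p L')
    define x where "x = snd p"
    have xL: "x \<in> snd ` set L" and xM: "x \<in> snd ` set M"
      using sets by (auto simp: Cons x_def)
    let ?L = "filter (\<lambda>p. snd p \<noteq> x) L" and ?M = "filter (\<lambda>p. snd p \<noteq> x) M"
    have w: "?L \<in> weighted" "?M \<in> weighted"
      using less.prems by auto
    have "length ?L < length L"
      by (rule length_filter_less[of p]) (auto simp: Cons x_def)
    moreover have "weight ?L = weight ?M"
      using less.prems(3) by (simp add: weight_filter fun_eq_iff)
    ultimately have IH: "mass ?L = mass ?M" "combine ?L = combine ?M"
      using less.hyps w by blast+
    have tot: "mass L = mass M"
      using mass_split[of L x] mass_split[of M x] IH(1) less.prems(3) by simp
    show ?thesis
    proof (cases "?L = []")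
      case True
      \<comment> \<open>Only the empty list has mass 0, so equality of masses transfers
        emptiness.\<close>
      then have "?M = []"
        using mass_pos[OF w(2)] IH(1) by fastforce
      with True have "snd ` set L \<subseteq> {x}" "snd ` set M \<subseteq> {x}"
        by (auto simp: filter_empty_conv)
      then have "combine L = x" "combine M = x"
        using less.prems xL xM by (auto intro!: combine_const)
      then show ?thesis using tot by simp
    next
      case False
      then have "?M \<noteq> []"
        using mass_pos[OF w(1)] IH(1) by fastforce
      then show ?thesis
        using combine_collect[OF less.prems(1) xL False] combine_collect[OF less.prems(2) xM]
          IH tot less.prems(3) by simp
    qed
  qed
qed

text \<open>Only ratios of weights enter \<open>combine\<close>.\<close>

lemma combine_rescale: "0 < c \<Longrightarrow> combine (rescale c L) = combine L"
proof (induction L)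
  case (Cons p L)
  have "c * fst p / (c * fst p + c * mass L) = fst p / (fst p + mass L)"
    using Cons.prems by (simp flip: distrib_left)
  with Cons show ?case
    using mass_rescale[of c L] by (auto simp: rescale_def)
qed (simp add: rescale_def)

section \<open>Barycenters of finitely supported measures on X\<close>

definition barycenter :: "'a pmf \<Rightarrow> 'a" where
  "barycenter p = combine (SOME L. L \<in> weighted \<and> weight L = pmf p)"

text \<open>The choice in \<open>barycenter\<close> is harmless, since the value of a list depends
  only on its weights.\<close>

lemma barycenter_eq:
  assumes "L \<in> weighted" "weight L = pmf p"
  shows "barycenter p = combine L"
proof -
  let ?L = "SOME L. L \<in> weighted \<and> weight L = pmf p"
  have "?L \<in> weighted \<and> weight ?L = pmf p"
    by (rule someI[of _ L]) (use assms in simp)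
  then show ?thesis
    using combine_weight_cong[of ?L L] assms by (simp add: barycenter_def)
qed

lemma weighted_pmf:
  assumes "finite (set_pmf p)" "set_pmf p \<subseteq> X"
  obtains L where "L \<in> weighted" "weight L = pmf p" "mass L = 1"
proof -
  obtain xs where xs: "set xs = set_pmf p" "distinct xs"
    using finite_distinct_list[OF assms(1)] by blast
  let ?L = "map (\<lambda>x. (pmf p x, x)) xs"
  have "?L \<in> weighted"
    using assms(2) xs(1) by (auto simp: pmf_positive)
  moreover have "weight ?L = pmf p"
    by (auto simp: weight_distinct[OF xs(2)] xs(1) set_pmf_iff)
  moreover have "mass ?L = 1"
    using xs sum_pmf_eq_1[OF assms(1), of p]
    by (simp add: mass_def o_def sum_list_distinct_conv_sum_set)
  ultimately show thesis by (rule that)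
qed

lemma barycenter_closed:
  assumes "finite (set_pmf p)" "set_pmf p \<subseteq> X"
  shows "barycenter p \<in> X"
  using weighted_pmf[OF assms] barycenter_eq combine_closed mass_simps(1) zero_neq_one by metis

lemma barycenter_return:
  assumes "x \<in> X"
  shows "barycenter (return_pmf x) = x"
proof -
  have "barycenter (return_pmf x) = combine [(1, x)]"
    by (rule barycenter_eq) (use assms in \<open>auto simp: weight_def pmf_return indicator_def\<close>)
  then show ?thesis by simp
qed

lemma cc_1: "x \<in> X \<Longrightarrow> y \<in> X \<Longrightarrow> cc 1 x y = x"
  using commute[of 1 x y] zero[of y x] by simp

text \<open>Rescaling lists for p and q by l and 1 - l and concatenating them gives a list for the
  mixture, which \<open>combine_append\<close> evaluates.\<close>

lemma barycenter_mixture: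
  assumes l: "l \<in> {0..1}" and p: "finite (set_pmf p)" "set_pmf p \<subseteq> X"
    and q: "finite (set_pmf q)" "set_pmf q \<subseteq> X"
  shows "barycenter (bind_pmf (bernoulli_pmf l) (\<lambda>b. if b then p else q)) =
    cc l (barycenter p) (barycenter q)"
proof -
  have mem: "barycenter p \<in> X" "barycenter q \<in> X"
    using p q by (auto intro: barycenter_closed)
  have pmf: "pmf (bind_pmf (bernoulli_pmf l) (\<lambda>b. if b then p else q)) x =
      l * pmf p x + (1 - l) * pmf q x" for x
    using l by (simp add: pmf_bind)
  \<comment> \<open>At the endpoints one of the lists would be rescaled by 0 and lose positivity, so
    these cases are settled directly.\<close>
  consider "l = 0" | "l = 1" | "0 < l" "l < 1"
    using l by fastforce
  then show ?thesis
  proof cases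
    case 1
    have "bind_pmf (bernoulli_pmf l) (\<lambda>b. if b then p else q) = q"
      by (rule pmf_eqI, subst pmf) (simp add: 1)
    then show ?thesis using 1 zero mem by simp
  next
    case 2
    have "bind_pmf (bernoulli_pmf l) (\<lambda>b. if b then p else q) = p"
      by (rule pmf_eqI, subst pmf) (simp add: 2)
    then show ?thesis using 2 cc_1 mem by simp
  next
    case 3
    obtain L where L: "L \<in> weighted" "weight L = pmf p" "mass L = 1"
      using weighted_pmf[OF p] .
    obtain M where M: "M \<in> weighted" "weight M = pmf q" "mass M = 1"
      using weighted_pmf[OF q] .
    let ?L = "rescale l L" and ?M = "rescale (1 - l) M"
    have w: "?L \<in> weighted" "?M \<in> weighted"
      using rescale_weighted[of l L] rescale_weighted[of "1 - l" M] 3 L M by simp_all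
    have ne: "?L \<noteq> []" "?M \<noteq> []"
      using L M by (auto simp: rescale_def)
    have "barycenter (bind_pmf (bernoulli_pmf l) (\<lambda>b. if b then p else q)) = combine (?L @ ?M)"
      by (rule barycenter_eq) (use w in \<open>simp_all add: pmf fun_eq_iff L(2) M(2)\<close>)
    also have "\<dots> = cc l (combine L) (combine M)"
      using combine_append[OF w ne] L(3) M(3) 3
      by (simp add: combine_rescale)
    also have "\<dots> = cc l (barycenter p) (barycenter q)"
      using barycenter_eq L M by simp
    finally show ?thesis .
  qed
qed

section \<open>Existence\<close>

definition conv :: "nat pmf \<Rightarrow> 'a list \<Rightarrow> 'a" where
  "conv \<mu> xs = barycenter (map_pmf ((!) xs) \<mu>)"

lemma set_map_pmf_nth:
  assumes "\<mu> \<in> Prob n" "xs \<in> tuples X n"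
  shows "finite (set_pmf (map_pmf ((!) xs) \<mu>))" "set_pmf (map_pmf ((!) xs) \<mu>) \<subseteq> X"
  using assms by (auto simp: Prob_def tuples_def intro: finite_subset intro!: subsetD[OF _ nth_mem])

lemma conv_closed: "\<mu> \<in> Prob n \<Longrightarrow> xs \<in> tuples X n \<Longrightarrow> conv \<mu> xs \<in> X"
  unfolding conv_def by (intro barycenter_closed set_map_pmf_nth)

lemma conv_two_point:
  assumes l: "l \<in> {0..1}" and xy: "x \<in> X" "y \<in> X"
  shows "conv (two_point l) [x, y] = cc l x y"
proof -
  have "map_pmf ((!) [x, y]) (two_point l) =
      bind_pmf (bernoulli_pmf l) (\<lambda>b. if b then return_pmf x else return_pmf y)"
    unfolding two_point_def pmf.map_comp
    by (auto simp: map_pmf_def intro!: bind_pmf_cong)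
  then show ?thesis
    using barycenter_mixture[OF l, of "return_pmf x" "return_pmf y"] xy
    by (simp add: conv_def barycenter_return)
qed

text \<open>Permuting and merging leave the image measure on X unchanged, a unit mass yields a point
  mass, and joining yields the mixture of the two image measures.\<close>

lemma convex_like_conv: "convex_like X conv"
proof
  fix \<mu> n xs assume "\<mu> \<in> Prob n" "xs \<in> tuples X n"
  then show "conv \<mu> xs \<in> X" by (rule conv_closed)
next
  fix \<mu> n xs \<sigma> assume \<mu>: "\<mu> \<in> Prob n" and xs: "xs \<in> tuples X n" and \<sigma>: "\<sigma> permutes {..<n}"
  \<comment> \<open>The mass at i moves to \<open>inv \<sigma> i\<close>, where the permuted list
    holds \<open>xs ! i\<close>.\<close>
  have "map_pmf ((!) (permute_list \<sigma> xs)) (permute_pmf \<sigma> \<mu>) = map_pmf ((!) xs) \<mu>"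
    unfolding permute_pmf_def pmf.map_comp
  proof (rule map_pmf_cong)
    fix i assume "i \<in> set_pmf \<mu>"
    then have "i < n" using \<mu> by (auto simp: Prob_def)
    then have "inv \<sigma> i < n"
      using permutes_in_image[OF permutes_inv[OF \<sigma>]] by auto
    then show "((!) (permute_list \<sigma> xs) \<circ> inv \<sigma>) i = xs ! i"
      using xs \<sigma> permute_list_nth[of \<sigma> xs "inv \<sigma> i"]
      by (simp add: tuples_def permutes_inverses(1)[OF \<sigma>])
  qed simp
  then show "conv \<mu> xs = conv (permute_pmf \<sigma> \<mu>) (permute_list \<sigma> xs)"
    by (simp add: conv_def)
next
  fix n \<mu> and x y :: 'a and xs assume "x = y"
  \<comment> \<open>Truncated subtraction identifies only the positions 0 and 1, which hold the same
    point.\<close>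
  then have "map_pmf ((!) (x # xs)) (merge_pmf \<mu>) = map_pmf ((!) (x # y # xs)) \<mu>"
    unfolding merge_pmf_def pmf.map_comp
    by (intro map_pmf_cong) (auto simp: nth_Cons split: nat.splits)
  then show "conv \<mu> (x # y # xs) = conv (merge_pmf \<mu>) (x # xs)"
    by (simp add: conv_def)
next
  fix \<mu> n xs i assume "xs \<in> tuples X n" "i < n" "pmf \<mu> i = 1"
  moreover from this(3) have "\<mu> = return_pmf i" by (rule pmf_eq_1)
  ultimately show "conv \<mu> xs = xs ! i"
    by (auto simp: conv_def tuples_def intro!: barycenter_return)
next
  fix \<nu> \<mu> n \<mu>' m xs ys
  assume \<nu>: "\<nu> \<in> Prob 2" and \<mu>: "\<mu> \<in> Prob n" and \<mu>': "\<mu>' \<in> Prob m"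
    and xs: "xs \<in> tuples X n" and ys: "ys \<in> tuples X m"
  define l where "l = pmf \<nu> 0"
  have l: "l \<in> {0..1}" by (simp add: l_def pmf_le_1)
  have \<nu>_eq: "\<nu> = two_point l"
    using Prob_2_eq_two_point[OF \<nu>] by (simp add: l_def)
  let ?p = "map_pmf ((!) xs) \<mu>" and ?q = "map_pmf ((!) ys) \<mu>'"
  \<comment> \<open>The support of \<mu> lies below n, so it reads the concatenation inside xs; the
    shift by n = \<open>length xs\<close> makes \<mu>' read ys.\<close>
  have 1: "map_pmf ((!) (xs @ ys)) \<mu> = ?p"
    using \<mu> xs by (intro map_pmf_cong) (auto simp: Prob_def tuples_def nth_append)
  have 2: "map_pmf ((!) (xs @ ys)) (map_pmf (\<lambda>j. n + j) \<mu>') = ?q"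
    unfolding pmf.map_comp using xs by (intro map_pmf_cong) (auto simp: tuples_def)
  have "map_pmf ((!) (xs @ ys)) (join_pmf n \<nu> \<mu> \<mu>') =
      bind_pmf \<nu> (\<lambda>k. if k = 0 then ?p else ?q)"
    unfolding join_pmf_def map_bind_pmf by (intro bind_pmf_cong) (auto simp: 1 2)
  then have "conv (join_pmf n \<nu> \<mu> \<mu>') (xs @ ys) = cc l (conv \<mu> xs) (conv \<mu>' ys)"
    unfolding conv_def
    using barycenter_mixture[OF l set_map_pmf_nth[OF \<mu> xs] set_map_pmf_nth[OF \<mu>' ys]]
    by (simp add: \<nu>_eq bind_two_point)
  then show "conv \<nu> [conv \<mu> xs, conv \<mu>' ys] = conv (join_pmf n \<nu> \<mu> \<mu>') (xs @ ys)"
    using conv_two_point[OF l conv_closed[OF \<mu> xs] conv_closed[OF \<mu>' ys]] by (simp add: \<nu>_eq)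
qed

end

section \<open>The correspondence between the two structures\<close>

theorem theorem3:
  fixes X :: "'a set"
  shows "(\<forall>\<gamma>. convex_like X \<gamma> \<longrightarrow> convex_space X (\<lambda>l x y. \<gamma> (two_point l) [x, y])) \<and>
    (\<forall>cc. convex_space X cc \<longrightarrow>
      (\<exists>\<gamma>. convex_like X \<gamma> \<and> corresponds X \<gamma> cc \<and>
        (\<forall>\<gamma>'. convex_like X \<gamma>' \<and> corresponds X \<gamma>' cc \<longrightarrow>
          (\<forall>n\<ge>1. \<forall>\<mu>\<in>Prob n. \<forall>xs\<in>tuples X n. \<gamma>' \<mu> xs = \<gamma> \<mu> xs))))"
proof (intro conjI allI impI)
  fix \<gamma> assume "convex_like X \<gamma>"
  then show "convex_space X (\<lambda>l x y. \<gamma> (two_point l) [x, y])"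
    by (rule convex_like.convex_space)
next
  fix cc assume "convex_space X cc"
  then interpret convex_space X cc .
  have corr: "corresponds X conv cc"
    by (simp add: corresponds_def conv_two_point)
  show "\<exists>\<gamma>. convex_like X \<gamma> \<and> corresponds X \<gamma> cc \<and>
        (\<forall>\<gamma>'. convex_like X \<gamma>' \<and> corresponds X \<gamma>' cc \<longrightarrow>
          (\<forall>n\<ge>1. \<forall>\<mu>\<in>Prob n. \<forall>xs\<in>tuples X n. \<gamma>' \<mu> xs = \<gamma> \<mu> xs))"
  proof (intro exI[of _ conv] conjI allI impI ballI)
    fix \<gamma>' n \<mu> xs
    assume \<gamma>': "convex_like X \<gamma>' \<and> corresponds X \<gamma>' cc" and \<mu>: "\<mu> \<in> Prob n" "xs \<in> tuples X n"
    show "\<gamma>' \<mu> xs = conv \<mu> xs"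
    proof (rule convex_like_unique[OF _ convex_like_conv _ \<mu>])
      show "convex_like X \<gamma>'" using \<gamma>' ..
      fix l x y assume "l \<in> {0..1::real}" "x \<in> X" "y \<in> X"
      then show "\<gamma>' (two_point l) [x, y] = conv (two_point l) [x, y]"
        using \<gamma>' corr unfolding corresponds_def by metis
    qed
  qed (fact convex_like_conv corr)+
qed

end
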